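(* Let $p_1,p_2$ be odd prime numbers with $5\le p_1<p_2$, and let $m$ be an integer with $p_2-p_1<m<p_1$. Let $D\subset\mathbb C^3$ be a bounded quasi-circular domain containing the origin, with weight $(m,p_1,p_2)$. Then every holomorphic automorphism $f$ of $D$ with $f(0)=0$ is linear, i.e. is the restriction to $D$ of a $\mathbb C$-linear map $\mathbb C^3\to\mathbb C^3$.
   Context: A domain (connected open set) $D\subset\mathbb C^3$ is quasi-circular with weight $(m_1,m_2,m_3)$ (positive integers with greatest common divisor $1$) if for every $\theta\in\mathbb R$ it is invariant under the map $(z_1,z_2,z_3)\mapsto(e^{im_1\theta}z_1,e^{im_2\theta}z_2,e^{im_3\theta}z_3)$. A holomorphic automorphism of $D$ is a biholomorphic map $D\to D$. *)

theory Defs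
  imports "HOL-Analysis.Analysis" "HOL-Computational_Algebra.Primes"
begin

text \<open>
  The product \<open>*s\<close> is multiplication of a vector by a complex scalar, so
  \<open>Vector_Spaces.linear (*s) (*s)\<close> is linearity over the complex numbers. A derivative in the
  sense of \<open>has_derivative\<close> is only real linear; requiring it to be complex linear at every point
  of an open set gives holomorphy in several variables.
\<close>

abbreviation complex_linear :: "(complex ^ 'n \<Rightarrow> complex ^ 'm) \<Rightarrow> bool" where
  "complex_linear L \<equiv> Vector_Spaces.linear (*s) (*s) L"

definition holomorphic_map_on ::
  "(complex ^ 'n \<Rightarrow> complex ^ 'm) \<Rightarrow> (complex ^ 'n) set \<Rightarrow> bool" where
  "holomorphic_map_on f D \<longleftrightarrow>
     open D \<and> (\<forall>z\<in>D. \<exists>L. complex_linear L \<and> (f has_derivative L) (at z))"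

text \<open>Only the values of \<open>f\<close> on \<open>D\<close> matter in the following definition, as \<open>D\<close> is open.\<close>

definition holomorphic_automorphism ::
  "(complex ^ 'n) set \<Rightarrow> (complex ^ 'n \<Rightarrow> complex ^ 'n) \<Rightarrow> bool" where
  "holomorphic_automorphism D f \<longleftrightarrow>
     bij_betw f D D \<and> holomorphic_map_on f D \<and> holomorphic_map_on (inv_into D f) D"

definition weighted_rotation :: "int ^ 3 \<Rightarrow> real \<Rightarrow> complex ^ 3 \<Rightarrow> complex ^ 3" where
  "weighted_rotation w \<theta> z = (\<chi> i. cis (of_int (w $ i) * \<theta>) * z $ i)"

definition quasi_circular_domain :: "int ^ 3 \<Rightarrow> (complex ^ 3) set \<Rightarrow> bool" where
  "quasi_circular_domain w D \<longleftrightarrow>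
     open D \<and> connected D \<and>
     (\<forall>i. w $ i > 0) \<and> Gcd (range (\<lambda>i. w $ i)) = 1 \<and>
     (\<forall>\<theta>. weighted_rotation w \<theta> ` D = D)"

end

theory Submission
  imports Defs "HOL-Complex_Analysis.Conformal_Mappings"
begin

text \<open>
  Let \<open>\<rho>\<close> denote the weighted rotations and, for an automorphism \<open>g\<close> of \<open>D\<close> fixing \<open>0\<close>, put
  \<open>\<Phi>\<^sub>g = g'(0)\<^sup>-\<^sup>1 \<circ> g\<close>. The hypotheses on the weights say that there are no resonances, so
  the mean of \<open>\<rho>\<^sup>-\<^sup>1 \<circ> E \<circ> \<rho>\<close> over the circle vanishes near \<open>0\<close> for every holomorphic \<open>E\<close>
  with \<open>E(0) = 0\<close> and \<open>E'(0) = 0\<close>. Apply this to \<open>E = \<Phi>\<^sub>f - id\<close>. Since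
  \<open>\<Phi>\<^bsub>f\<rho>g\<^esub> = \<Phi>\<^sub>g + g'(0)\<^sup>-\<^sup>1 \<circ> \<rho>\<^sup>-\<^sup>1 \<circ> E \<circ> \<rho> \<circ> g\<close>, the last term has mean zero, and the mean
  over \<open>\<rho>\<close> of the sum of the \<open>|\<Phi>\<^bsub>f\<rho>g\<^esub>|\<^sup>2\<close> over a finite set of points exceeds the corresponding
  sum for \<open>g\<close> by the mean square of that term. If \<open>E\<close> did not vanish near \<open>0\<close>, a fine enough
  finite set would make this excess bounded below uniformly in \<open>g\<close>. This is impossible because
  the Cauchy estimates bound \<open>\<Phi>\<^sub>g\<close> near \<open>0\<close> uniformly in \<open>g\<close>. Hence \<open>E = 0\<close> near \<open>0\<close>,
  and on all of \<open>D\<close> by the identity theorem.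
\<close>

section \<open>Holomorphic maps in several variables\<close>

lemma norm_vector_smult: "norm (c *s v) = norm c * norm v" for v :: "complex ^ 'n"
  by (simp add: norm_vec_def norm_mult L2_set_right_distrib)

lemma norm_le_sum_components: "norm v \<le> (\<Sum>i\<in>UNIV. norm (v $ i))" for v :: "complex ^ 'n"
  by (simp add: norm_vec_def L2_set_le_sum)

lemma complex_linear_imp_bounded_linear:
  fixes L :: "complex ^ 'n \<Rightarrow> complex ^ 'm"
  assumes "complex_linear L"
  shows "bounded_linear L"
proof -
  have *: "r *\<^sub>R v = complex_of_real r *s v" for r :: real and v :: "complex ^ 'k"
    by (simp add: vec_eq_iff scaleR_conv_of_real[where 'a=complex])
  show ?thesis
    using assms by (auto intro!: linear_conv_bounded_linear[THEN iffD1] linearI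
        simp: * vec.linear_add vec.linear_scale)
qed

lemma complex_linear_smult:
  "complex_linear L \<Longrightarrow> L (c *s v) = c *s L v"
  by (rule vec.linear_scale)

lemma complex_linear_compose:
  "complex_linear L \<Longrightarrow> complex_linear K \<Longrightarrow> complex_linear (\<lambda>z. L (K z))"
  using Vector_Spaces.linear_compose[of "(*s)" "(*s)" K "(*s)" L] by (simp add: o_def)

lemma complex_linear_ident: "complex_linear (\<lambda>z :: complex ^ 'n. z)"
  by (rule vec.linear_id[unfolded id_def])

lemma complex_linear_diff:
  "complex_linear L \<Longrightarrow> complex_linear K \<Longrightarrow> complex_linear (\<lambda>z. L z - K z)"
  by (rule vec.linear_compose_sub)

lemma holomorphic_map_onE:
  assumes "holomorphic_map_on f D" "z \<in> D"
  obtains L where "complex_linear L" "(f has_derivative L) (at z)"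
  using assms unfolding holomorphic_map_on_def by blast

lemma holomorphic_map_on_continuous_on:
  "holomorphic_map_on f D \<Longrightarrow> continuous_on D f"
  by (meson continuous_at_imp_continuous_on has_derivative_continuous holomorphic_map_onE)

lemma holomorphic_map_on_subset:
  "holomorphic_map_on f D \<Longrightarrow> open U \<Longrightarrow> U \<subseteq> D \<Longrightarrow> holomorphic_map_on f U"
  unfolding holomorphic_map_on_def by blast

lemma complex_linear_holomorphic_map_on:
  assumes "complex_linear L" "open D"
  shows "holomorphic_map_on L D"
  unfolding holomorphic_map_on_def
  using assms bounded_linear_imp_has_derivative complex_linear_imp_bounded_linear by blast

lemma holomorphic_map_on_compose:
  assumes "holomorphic_map_on f D" "holomorphic_map_on g U" "g ` U \<subseteq> D"
  shows "holomorphic_map_on (\<lambda>z. f (g z)) U"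
  unfolding holomorphic_map_on_def
proof (intro conjI ballI)
  show "open U" using assms(2) by (simp add: holomorphic_map_on_def)
  fix z assume "z \<in> U"
  then obtain K where K: "complex_linear K" "(g has_derivative K) (at z)"
    using assms(2) holomorphic_map_onE by blast
  obtain L where L: "complex_linear L" "(f has_derivative L) (at (g z))"
    using assms(1,3) \<open>z \<in> U\<close> holomorphic_map_onE by blast
  show "\<exists>M. complex_linear M \<and> ((\<lambda>z. f (g z)) has_derivative M) (at z)"
    using complex_linear_compose[OF L(1) K(1)] has_derivative_compose[OF K(2) L(2)] by blast
qed

lemma holomorphic_map_on_diff:
  assumes "holomorphic_map_on f D" "holomorphic_map_on g D"
  shows "holomorphic_map_on (\<lambda>z. f z - g z) D"
  unfolding holomorphic_map_on_def
proof (intro conjI ballI)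
  show "open D" using assms(1) by (simp add: holomorphic_map_on_def)
  fix z assume "z \<in> D"
  obtain L where L: "complex_linear L" "(f has_derivative L) (at z)"
    using holomorphic_map_onE[OF assms(1) \<open>z \<in> D\<close>] .
  obtain K where K: "complex_linear K" "(g has_derivative K) (at z)"
    using holomorphic_map_onE[OF assms(2) \<open>z \<in> D\<close>] .
  show "\<exists>M. complex_linear M \<and> ((\<lambda>z. f z - g z) has_derivative M) (at z)"
    using complex_linear_diff[OF L(1) K(1)] has_derivative_diff[OF L(2) K(2)] by blast
qed

lemma holomorphic_map_on_translate:
  assumes "holomorphic_map_on f D" "open U" "(\<lambda>z. a + z) ` U \<subseteq> D"
  shows "holomorphic_map_on (\<lambda>z. f (a + z)) U"
proof (rule holomorphic_map_on_compose[OF assms(1) _ assms(3)])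
  show "holomorphic_map_on ((+) a) U"
    unfolding holomorphic_map_on_def
    using assms(2) complex_linear_ident by (auto intro!: exI[of _ "\<lambda>z. z"] derivative_eq_intros)
qed

lemma continuous_on_vector_smult:
  fixes v :: "complex ^ 'n"
  assumes "continuous_on S g"
  shows "continuous_on S (\<lambda>t. g t *s v)"
  unfolding vector_scalar_mult_def by (intro continuous_intros assms)

section \<open>Restriction of holomorphic maps to complex curves\<close>

lemma has_derivative_curve:
  fixes \<gamma> :: "complex \<Rightarrow> complex ^ 'n"
  assumes "\<And>i. ((\<lambda>t. \<gamma> t $ i) has_field_derivative d $ i) (at t)"
  shows "(\<gamma> has_derivative (\<lambda>h. h *s d)) (at t)"
proof (subst has_derivative_componentwise_within, intro ballI)
  fix b :: "complex ^ 'n" assume "b \<in> Basis"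
  then obtain i c where b: "b = axis i c"
    by (auto simp: Basis_vec_def)
  have "((\<lambda>t. \<gamma> t $ i \<bullet> c) has_derivative (\<lambda>h. (d $ i * h) \<bullet> c)) (at t)"
    using assms[of i] unfolding has_field_derivative_def by (rule has_derivative_inner_left)
  then show "((\<lambda>t. \<gamma> t \<bullet> b) has_derivative (\<lambda>h. (h *s d) \<bullet> b)) (at t)"
    by (simp add: b inner_axis mult.commute)
qed

text \<open>By the chain rule the derivative is \<open>h \<mapsto> L (h *s d) $ j\<close>. Complex
  linearity of \<open>L\<close> makes this multiplication by a complex number, which opens the way
  to complex analysis in one variable.\<close>

lemma holomorphic_map_on_curve_derivative:
  assumes "complex_linear L" "(f has_derivative L) (at (\<gamma> t))"
    and "\<And>i. ((\<lambda>t. \<gamma> t $ i) has_field_derivative d $ i) (at t)"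
  shows "((\<lambda>t. f (\<gamma> t) $ j) has_field_derivative L d $ j) (at t)"
proof -
  have "((\<lambda>t. f (\<gamma> t)) has_derivative (\<lambda>h. L (h *s d))) (at t)"
    using has_derivative_compose[OF has_derivative_curve[OF assms(3)] assms(2)] .
  then have "((\<lambda>t. f (\<gamma> t) $ j) has_derivative (\<lambda>h. L (h *s d) $ j)) (at t)"
    by (rule bounded_linear.has_derivative[OF bounded_linear_vec_nth])
  moreover have "(\<lambda>h. L (h *s d) $ j) = (*) (L d $ j)"
    using assms(1) by (auto simp: complex_linear_smult)
  ultimately show ?thesis by (simp add: has_field_derivative_def)
qed

lemma holomorphic_on_curve:
  assumes f: "holomorphic_map_on f D" and "open S"
    and \<gamma>: "\<And>i. (\<lambda>t. \<gamma> t $ i) holomorphic_on S" "\<gamma> ` S \<subseteq> D"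
  shows "(\<lambda>t. f (\<gamma> t) $ j) holomorphic_on S"
  unfolding holomorphic_on_open[OF \<open>open S\<close>]
proof
  fix t assume t: "t \<in> S"
  obtain L where L: "complex_linear L" "(f has_derivative L) (at (\<gamma> t))"
    using f \<gamma>(2) t holomorphic_map_onE by blast
  show "\<exists>d. ((\<lambda>t. f (\<gamma> t) $ j) has_field_derivative d) (at t)"
    using holomorphic_map_on_curve_derivative[of L f \<gamma> t, OF L, of "\<chi> i. deriv (\<lambda>t. \<gamma> t $ i) t"]
      holomorphic_derivI[OF \<gamma>(1) \<open>open S\<close> t] by auto
qed

section \<open>Cauchy estimates and Lipschitz bounds\<close>

text \<open>Each component of \<open>f\<close> is restricted to the complex line
  \<open>z + t *s v\<close>, where the one-variable Cauchy inequality applies on the disc of radius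
  \<open>r / norm v\<close>. The factor \<open>CARD('m)\<close> comes from summing over the
  components.\<close>

lemma Cauchy_derivative_bound:
  fixes f :: "complex ^ 'n \<Rightarrow> complex ^ 'm"
  assumes f: "holomorphic_map_on f D" and D: "cball z r \<subseteq> D" and r: "0 < r"
    and M: "\<And>y. y \<in> cball z r \<Longrightarrow> norm (f y) \<le> M"
    and L: "complex_linear L" "(f has_derivative L) (at z)"
  shows "norm (L v) \<le> real CARD('m) * M / r * norm v"
proof (cases "v = 0")
  case True
  then show ?thesis
    using complex_linear_imp_bounded_linear[OF L(1)] linear_simps(3) by fastforce
next
  case False
  define R where "R = r / norm v"
  have R: "R > 0" using r False by (simp add: R_def)
  define \<gamma> where "\<gamma> = (\<lambda>t. z + t *s v)"
  have \<gamma>b: "\<gamma> ` cball 0 R \<subseteq> cball z r"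
    using False by (auto simp: \<gamma>_def dist_norm norm_vector_smult R_def field_simps)
  have op: "open (\<gamma> -` D)"
  proof (rule open_vimage)
    show "open D" using f by (simp add: holomorphic_map_on_def)
    show "continuous_on UNIV \<gamma>"
      unfolding \<gamma>_def by (intro continuous_intros continuous_on_vector_smult)
  qed
  have comp: "norm (L v $ j) \<le> M / R" for j
  proof -
    have hol: "(\<lambda>t. f (\<gamma> t) $ j) holomorphic_on (\<gamma> -` D)"
      by (rule holomorphic_on_curve[OF f op]) (auto simp: \<gamma>_def intro!: holomorphic_intros)
    have sub: "cball 0 R \<subseteq> \<gamma> -` D" using \<gamma>b D by blast
    have "norm ((deriv ^^ 1) (\<lambda>t. f (\<gamma> t) $ j) 0) \<le> fact 1 * M / R ^ 1"
    proof (rule Cauchy_inequality)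
      show "(\<lambda>t. f (\<gamma> t) $ j) holomorphic_on ball 0 R"
        by (rule holomorphic_on_subset[OF hol]) (use sub in auto)
      show "continuous_on (cball 0 R) (\<lambda>t. f (\<gamma> t) $ j)"
        by (rule continuous_on_subset[OF holomorphic_on_imp_continuous_on[OF hol] sub])
      fix x :: complex assume "norm (0 - x) = R"
      then have "\<gamma> x \<in> cball z r" using \<gamma>b by force
      from M[OF this] show "norm (f (\<gamma> x) $ j) \<le> M"
        by (rule order_trans[OF Finite_Cartesian_Product.norm_nth_le])
    qed (use R in auto)
    moreover have "((\<lambda>t. f (\<gamma> t) $ j) has_field_derivative L v $ j) (at 0)"
      by (rule holomorphic_map_on_curve_derivative[OF L(1)])
        (auto simp: \<gamma>_def L(2) intro!: derivative_eq_intros)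
    ultimately show ?thesis by (simp add: DERIV_imp_deriv)
  qed
  have "norm (L v) \<le> (\<Sum>i\<in>UNIV. norm (L v $ i))" by (rule norm_le_sum_components)
  also have "\<dots> \<le> real CARD('m) * (M / R)"
    using sum_bounded_above[of UNIV "\<lambda>i. norm (L v $ i)" "M / R"] comp by simp
  finally show ?thesis by (simp add: R_def)
qed

text \<open>Around every point of \<open>cball 0 r\<close> there is room for a ball of radius
  \<open>r\<close> inside \<open>cball 0 (2 * r)\<close>, so one derivative bound serves the whole
  convex ball and the mean value inequality applies.\<close>

lemma Cauchy_lipschitz:
  fixes f :: "complex ^ 'n \<Rightarrow> complex ^ 'm"
  assumes f: "holomorphic_map_on f D" and D: "cball 0 (2 * r) \<subseteq> D" and r: "0 < r"
    and M: "\<And>y. y \<in> cball 0 (2 * r) \<Longrightarrow> norm (f y) \<le> M"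
    and xy: "x \<in> cball 0 r" "y \<in> cball 0 r"
  shows "norm (f x - f y) \<le> real CARD('m) * M / r * norm (x - y)"
proof -
  have "\<exists>L. complex_linear L \<and> (f has_derivative L) (at z)" if "z \<in> cball 0 r" for z
    using f D r that unfolding holomorphic_map_on_def by (auto simp: subset_iff)
  then obtain L where L: "\<And>z. z \<in> cball 0 r \<Longrightarrow> complex_linear (L z)"
      "\<And>z. z \<in> cball 0 r \<Longrightarrow> (f has_derivative L z) (at z)"
    by metis
  show ?thesis
  proof (rule differentiable_bound[OF convex_cball[of 0 r] _ _ xy])
    fix z :: "complex ^ 'n" assume z: "z \<in> cball 0 r"
    show "(f has_derivative L z) (at z within cball 0 r)"
      using L(2)[OF z] by (rule has_derivative_at_withinI)
    have "cball z r \<subseteq> cball 0 (2 * r)"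
      using z by (auto simp: dist_norm) (smt (verit) norm_triangle_sub norm_minus_commute)
    then have "norm (L z v) \<le> real CARD('m) * M / r * norm v" for v
      using D M by (intro Cauchy_derivative_bound[OF f _ r _ L(1)[OF z] L(2)[OF z]]) blast+
    then show "onorm (L z) \<le> real CARD('m) * M / r" by (rule onorm_le)
  qed
qed

text \<open>The derivative vanishes at \<open>0\<close> and is \<open>O(norm z)\<close> at
  \<open>z\<close>, so the Lipschitz constant on a ball shrinks linearly with its radius. This
  replaces a second-order Taylor expansion of \<open>E\<close>.\<close>

lemma lipschitz_of_derivative_zero:
  fixes E :: "complex ^ 'n \<Rightarrow> complex ^ 'm"
  assumes E: "holomorphic_map_on E D" and "0 \<in> D" and E0: "(E has_derivative (\<lambda>_. 0)) (at 0)"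
  obtains C s where "C \<ge> 0" "s > 0" "cball 0 s \<subseteq> D"
    "\<And>\<rho> x y. \<rho> \<le> s \<Longrightarrow> x \<in> cball 0 \<rho> \<Longrightarrow> y \<in> cball 0 \<rho> \<Longrightarrow> norm (E x - E y) \<le> C * \<rho> * norm (x - y)"
proof -
  have "open D" using E by (simp add: holomorphic_map_on_def)
  then obtain r0 where "r0 > 0" "cball 0 r0 \<subseteq> D" using \<open>0 \<in> D\<close> open_contains_cball by blast
  then obtain r where r: "r > 0" and rD: "cball 0 (2 * r) \<subseteq> D"
    by (metis field_sum_of_halves half_gt_zero mult_2)
  have "bounded (E ` cball 0 (2 * r))"
    by (intro compact_imp_bounded compact_continuous_image compact_cball
        continuous_on_subset[OF holomorphic_map_on_continuous_on[OF E] rD])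
  then obtain M where M: "M > 0" "\<And>y. y \<in> cball 0 (2 * r) \<Longrightarrow> norm (E y) \<le> M"
    by (auto simp: bounded_pos)
  define K where "K = real CARD('m) * M / r"
  have K: "norm (E x - E y) \<le> K * norm (x - y)" if "x \<in> cball 0 r" "y \<in> cball 0 r" for x y
    unfolding K_def by (rule Cauchy_lipschitz[OF E rD r M(2) that])
  have "K \<ge> 0" using M(1) r by (simp add: K_def)
  \<comment> \<open>With \<open>norm z \<le> s\<close> and \<open>norm y \<le> s\<close> the point
    \<open>z + y\<close> stays in \<open>cball 0 r\<close>, where the Lipschitz bound
    \<open>K\<close> is available.\<close>
  define s where "s = r / 2"
  have s: "s > 0" using r by (simp add: s_def)
  define C where "C = real CARD('m) * K / s"
  \<comment> \<open>Applying the Cauchy estimate to \<open>y \<mapsto> E (z + y) - E y\<close>, which is \<open>O(norm z)\<close>, avoids second derivatives.\<close>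
  have D': "norm (L v) \<le> C * norm z * norm v"
    if z: "norm z \<le> s" and L: "complex_linear L" "(E has_derivative L) (at z)" for z L v
  proof -
    have "norm (L v) \<le> real CARD('m) * (K * norm z) / s * norm v"
    proof (rule Cauchy_derivative_bound[of "\<lambda>y. E (z + y) - E y" "ball 0 r" 0])
      have "norm (z + y) \<le> 2 * r" if "norm y < r" for y
        using that z r norm_triangle_ineq[of z y] by (simp add: s_def)
      then have sub: "(\<lambda>y. z + y) ` ball 0 r \<subseteq> D"
        using rD by (force simp del: image_add_ball)
      show "holomorphic_map_on (\<lambda>y. E (z + y) - E y) (ball 0 r)"
      proof (intro holomorphic_map_on_diff holomorphic_map_on_translate[OF E _ sub]
          holomorphic_map_on_subset[OF E] open_ball)
        show "ball 0 r \<subseteq> D" using r by (intro subset_trans[OF _ rD]) auto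
      qed
      show "cball 0 s \<subseteq> ball (0 :: complex ^ 'n) r" using r by (auto simp: s_def)
      show "norm (E (z + y) - E y) \<le> K * norm z" if "y \<in> cball 0 s" for y
        using K[of "z + y" y] that z norm_triangle_ineq[of z y] r by (simp add: s_def)
      have d: "((\<lambda>y. E (z + y)) has_derivative L) (at 0)"
        using has_derivative_compose[of "\<lambda>y. z + y" "\<lambda>y. y" 0 UNIV E L] L(2)
          has_derivative_add[OF has_derivative_const has_derivative_ident, of z "at 0"] by simp
      from has_derivative_diff[OF d E0]
      show "s > 0" "complex_linear L" "((\<lambda>y. E (z + y) - E y) has_derivative L) (at 0)"
        using s L(1) by simp_all
    qed
    then show ?thesis by (simp add: C_def)
  qed
  have "\<exists>L. complex_linear L \<and> (E has_derivative L) (at z)" if "norm z \<le> s" for z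
    using E rD r that unfolding holomorphic_map_on_def by (auto simp: subset_iff s_def)
  then obtain L where L: "\<And>z. norm z \<le> s \<Longrightarrow> complex_linear (L z)"
      "\<And>z. norm z \<le> s \<Longrightarrow> (E has_derivative L z) (at z)"
    by metis
  have C: "C \<ge> 0" using \<open>K \<ge> 0\<close> s by (simp add: C_def)
  show ?thesis
  proof (rule that[OF C s])
    show "cball 0 s \<subseteq> D" using rD r by (auto simp: s_def)
    fix \<rho> and x y :: "complex ^ 'n" assume \<rho>: "\<rho> \<le> s" and xy: "x \<in> cball 0 \<rho>" "y \<in> cball 0 \<rho>"
    show "norm (E x - E y) \<le> C * \<rho> * norm (x - y)"
    proof (rule differentiable_bound[OF convex_cball[of 0 \<rho>] _ _ xy])
      fix z :: "complex ^ 'n" assume z: "z \<in> cball 0 \<rho>"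
      then have zs: "norm z \<le> s" "norm z \<le> \<rho>" using \<rho> by auto
      show "(E has_derivative L z) (at z within cball 0 \<rho>)"
        using L(2)[OF zs(1)] by (rule has_derivative_at_withinI)
      show "onorm (L z) \<le> C * \<rho>"
      proof (rule onorm_le)
        fix v
        have "norm (L z v) \<le> C * norm z * norm v" using D' L zs by blast
        also have "\<dots> \<le> C * \<rho> * norm v" using C zs order_trans[OF norm_ge_zero zs(2)] by (intro mult_mono) auto
        finally show "norm (L z v) \<le> C * \<rho> * norm v" .
      qed
    qed
  qed
qed

section \<open>Identity theorem\<close>

text \<open>The interior \<open>Z\<close> of the zero set is nonempty, open and relatively closed in
  the connected set \<open>D\<close>.\<close>

lemma holomorphic_map_identity_theorem:
  fixes F :: "complex ^ 'n \<Rightarrow> complex ^ 'm"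
  assumes F: "holomorphic_map_on F D" and "connected D" and a: "a \<in> D"
    and e: "e > 0" "\<And>z. z \<in> ball a e \<Longrightarrow> F z = 0"
    and "z \<in> D"
  shows "F z = 0"
proof -
  have op: "open D" using F by (simp add: holomorphic_map_on_def)
  define Z where "Z = interior {z \<in> D. F z = 0}"
  have ZD: "Z \<subseteq> D" using interior_subset by (force simp: Z_def)
  \<comment> \<open>On the complex line through \<open>b\<close> and \<open>y\<close>, the
    parameters landing in the ball form an open convex set containing \<open>0\<close> and
    \<open>1\<close>. The components of \<open>F\<close> vanish near the parameter \<open>0\<close>,
    hence also at \<open>1\<close>.\<close>
  have spread: "ball c r \<subseteq> Z" if c: "ball c r \<subseteq> D" and b: "b \<in> Z" "b \<in> ball c r" for b c r
  proof -
    have "F y = 0" if y: "y \<in> ball c r" for y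
    proof -
      define \<gamma> where "\<gamma> = (\<lambda>t. b + t *s (y - b))"
      have cont: "continuous_on UNIV \<gamma>" unfolding \<gamma>_def by (intro continuous_intros continuous_on_vector_smult)
      define S where "S = \<gamma> -` ball c r"
      have S: "open S" unfolding S_def by (rule open_vimage[OF open_ball cont])
      have "convex S"
      proof -
        have "S = (\<lambda>t. t *s (y - b)) -` ((\<lambda>w. w - b) ` ball c r)"
          by (force simp: S_def \<gamma>_def image_iff algebra_simps)
        moreover have "linear (\<lambda>t::complex. t *s (y - b))"
          by (rule linearI) (auto simp: vec_eq_iff algebra_simps)
        moreover have "convex ((\<lambda>w. w - b) ` ball c r)"
          by (intro convex_translation_subtract convex_ball)
        ultimately show ?thesis by (simp add: convex_linear_vimage)
      qed
      have "F (\<gamma> 1) $ j = 0" for j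
      proof (rule analytic_continuation[of "\<lambda>t. F (\<gamma> t) $ j" S])
        show "(\<lambda>t. F (\<gamma> t) $ j) holomorphic_on S"
          using c by (intro holomorphic_on_curve[OF F S]) (auto simp: \<gamma>_def S_def intro!: holomorphic_intros)
        show "connected S" using \<open>convex S\<close> by (rule convex_connected)
        have "open (\<gamma> -` Z)" by (rule open_vimage[OF _ cont]) (simp add: Z_def)
        moreover have "0 \<in> \<gamma> -` Z" using b by (simp add: \<gamma>_def)
        ultimately have "open (\<gamma> -` Z \<inter> S)" "0 \<in> \<gamma> -` Z \<inter> S"
          using S b by (auto simp: S_def \<gamma>_def)
        then show "0 islimpt (\<gamma> -` Z \<inter> S)" by (metis interior_limit_point interior_open)
        show "F (\<gamma> t) $ j = 0" if "t \<in> \<gamma> -` Z \<inter> S" for t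
          using that interior_subset[of "{z \<in> D. F z = 0}"] by (auto simp: Z_def)
        show "1 \<in> S" using y by (simp add: S_def \<gamma>_def)
        show "0 \<in> S" using b by (simp add: S_def \<gamma>_def)
      qed (use S in auto)
      then show ?thesis by (simp add: \<gamma>_def vec_eq_iff)
    qed
    then show ?thesis unfolding Z_def using c by (intro interior_maximal) auto
  qed
  have "openin (top_of_set D) Z" using ZD op by (simp add: openin_open_eq Z_def)
  moreover have "closedin (top_of_set D) Z"
    unfolding closedin_limpt
  proof (intro conjI ZD allI impI)
    fix x assume x: "x islimpt Z \<and> x \<in> D"
    then obtain r where r: "r > 0" "ball x r \<subseteq> D" using op open_contains_ball by blast
    obtain b where "b \<in> Z" "b \<in> ball x r"
      using x r(1) unfolding islimpt_def by (meson centre_in_ball open_ball)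
    then show "x \<in> Z" using spread[OF r(2)] centre_in_ball[of x r] r(1) by blast
  qed
  moreover have "a \<in> Z"
  proof -
    have "ball a e \<inter> D \<subseteq> {z \<in> D. F z = 0}" using e by auto
    then have "ball a e \<inter> D \<subseteq> Z" unfolding Z_def using op by (intro interior_maximal) auto
    then show ?thesis using a e by auto
  qed
  ultimately have "Z = D" using \<open>connected D\<close> connected_clopen by blast
  then show ?thesis using \<open>z \<in> D\<close> interior_subset unfolding Z_def by blast
qed

section \<open>Taylor coefficients on the circle\<close>

text \<open>The integral is the \<open>n\<close>-th Taylor coefficient of \<open>\<psi>\<close> at
  \<open>0\<close>, given by Cauchy's formula on the unit circle parametrised over
  \<open>{0..1}\<close>.\<close>

lemma Fourier_coefficient_circle:
  assumes "continuous_on (cball 0 1) \<psi>" "\<psi> holomorphic_on ball 0 1" "(deriv ^^ n) \<psi> 0 = 0"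
  shows "((\<lambda>x. cis (- (real n * (2 * pi * x))) * \<psi> (cis (2 * pi * x))) has_integral 0) {0..1}"
proof -
  have "((\<lambda>u. \<psi> u / (u - 0) ^ Suc n) has_contour_integral 0) (circlepath 0 1)"
    using Cauchy_has_contour_integral_higher_derivative_circlepath[OF assms(1,2), of 0 n] assms(3) by simp
  then have "((\<lambda>x. \<psi> (circlepath 0 1 x) / (circlepath 0 1 x) ^ Suc n *
      vector_derivative (circlepath 0 1) (at x)) has_integral 0) {0..1}"
    by (simp add: has_contour_integral)
  then have I: "((\<lambda>x. 1 / (2 * pi * \<i>) * (\<psi> (circlepath 0 1 x) / (circlepath 0 1 x) ^ Suc n *
      vector_derivative (circlepath 0 1) (at x))) has_integral 1 / (2 * pi * \<i>) * 0) {0..1}"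
    by (rule has_integral_mult_right)
  have c: "circlepath 0 1 x = cis (2 * pi * x)"
    "vector_derivative (circlepath 0 1) (at x) = 2 * pi * \<i> * cis (2 * pi * x)" for x
    using vector_derivative_circlepath[of 0 1 x] by (simp_all add: circlepath cis_conv_exp mult_ac)
  have e: "1 / (2 * pi * \<i>) * (\<psi> (circlepath 0 1 x) / (circlepath 0 1 x) ^ Suc n *
      vector_derivative (circlepath 0 1) (at x))
    = cis (- (real n * (2 * pi * x))) * \<psi> (cis (2 * pi * x))" for x
    unfolding c by (simp add: Complex.DeMoivre flip: cis_inverse) (simp add: field_simps)
  show ?thesis using I unfolding e by simp
qed

text \<open>The Cauchy inequality on a circle of radius \<open>r\<close> bounds the derivative by a
  multiple of \<open>r ^ (N - n)\<close>, which tends to \<open>0\<close> with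
  \<open>r\<close>.\<close>

lemma higher_deriv_zero_of_power_bound:
  fixes \<psi> :: "complex \<Rightarrow> complex"
  assumes hol: "\<psi> holomorphic_on ball 0 1" and "n < N"
    and b: "\<And>t. norm t < 1 \<Longrightarrow> norm (\<psi> t) \<le> K * norm t ^ N"
  shows "(deriv ^^ n) \<psi> 0 = 0"
proof -
  have "0 \<le> K * (1 / 2) ^ N"
    using b[of "1 / 2"] order_trans[OF norm_ge_zero] by (simp add: norm_divide)
  then have K: "K \<ge> 0" by (metis half_gt_zero less_numeral_extra(1) not_le mult_neg_pos zero_less_power)
  have *: "norm ((deriv ^^ n) \<psi> 0) \<le> fact n * K * r" if r: "0 < r" "r < 1" for r
  proof -
    have sub: "cball 0 r \<subseteq> ball (0::complex) 1" using r by auto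
    have "norm ((deriv ^^ n) \<psi> 0) \<le> fact n * (K * r ^ N) / r ^ n"
    proof (rule Cauchy_inequality)
      show "\<psi> holomorphic_on ball 0 r"
        by (rule holomorphic_on_subset[OF hol]) (use sub in auto)
      show "continuous_on (cball 0 r) \<psi>"
        by (rule continuous_on_subset[OF holomorphic_on_imp_continuous_on[OF hol] sub])
      show "norm (\<psi> x) \<le> K * r ^ N" if "norm (0 - x) = r" for x
        using b[of x] that r by simp
    qed (use r in auto)
    also have "\<dots> = fact n * K * r ^ (N - n)"
      using r \<open>n < N\<close> by (simp add: power_diff)
    also have "\<dots> \<le> fact n * K * r ^ 1"
      using r \<open>n < N\<close> K by (intro mult_left_mono power_decreasing) auto
    finally show ?thesis by simp
  qed
  have "norm ((deriv ^^ n) \<psi> 0) \<le> fact n * K * 0"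
  proof (rule tendsto_lowerbound)
    show "((\<lambda>r. fact n * K * r) \<longlongrightarrow> fact n * K * 0) (at_right (0::real))"
      by (intro tendsto_intros)
    show "\<forall>\<^sub>F r in at_right 0. norm ((deriv ^^ n) \<psi> 0) \<le> fact n * K * r"
      by (auto simp: eventually_at_right_field intro!: exI[of _ 1] *)
  qed auto
  then show ?thesis by simp
qed

lemma higher_deriv_zero_of_power_compose:
  fixes g :: "complex \<Rightarrow> complex"
  assumes hol: "(\<lambda>t. g (t ^ m)) holomorphic_on ball 0 1" and m: "m > 0" "\<not> m dvd n"
  shows "(deriv ^^ n) (\<lambda>t. g (t ^ m)) 0 = 0"
proof -
  \<comment> \<open>The function is invariant under the rotation \<open>u\<close>, which multiplies its \<open>n\<close>-th derivative at \<open>0\<close> by \<open>u ^ n\<close>.\<close>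
  define u where "u = cis (2 * pi / real m)"
  have um: "u ^ m = 1" using m by (simp add: u_def Complex.DeMoivre)
  \<comment> \<open>\<open>u\<close> is a primitive \<open>m\<close>-th root of unity.\<close>
  have un: "u ^ n \<noteq> 1"
  proof
    assume "u ^ n = 1"
    then have "cis (2 * pi * n / m) = 1" by (simp add: u_def Complex.DeMoivre mult_ac)
    then obtain k :: int where "2 * pi * n / m = 2 * pi * k"
      by (auto simp: cis_conv_exp exp_eq_1)
    then have "real n = real m * k" using m by (simp add: field_simps)
    then have "int n = int m * k" by (metis of_int_eq_iff of_int_mult of_int_of_nat_eq)
    then show False using m by (metis dvd_triv_left int_dvd_int_iff)
  qed
  have u1: "norm u = 1" by (simp add: u_def)
  have "(deriv ^^ n) (\<lambda>t. g ((u * t) ^ m)) 0 = u ^ n * (deriv ^^ n) (\<lambda>t. g (t ^ m)) (u * 0)"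
    by (rule higher_deriv_compose_linear[OF hol, where S = "ball 0 1"]) (auto simp: norm_mult u1)
  then have "(1 - u ^ n) * (deriv ^^ n) (\<lambda>t. g (t ^ m)) 0 = 0"
    by (simp add: power_mult_distrib um algebra_simps)
  then show ?thesis using un by simp
qed

section \<open>Automorphisms fixing the origin\<close>

text \<open>Carrying the inverse as a second map makes inversion a mere swap and keeps
  \<open>inv_into\<close> out of compositions.\<close>

definition automorphism_pair ::
  "(complex ^ 'n) set \<Rightarrow> (complex ^ 'n \<Rightarrow> complex ^ 'n) \<Rightarrow> (complex ^ 'n \<Rightarrow> complex ^ 'n) \<Rightarrow> bool" where
  "automorphism_pair D g h \<longleftrightarrow>
     holomorphic_map_on g D \<and> holomorphic_map_on h D \<and> g ` D \<subseteq> D \<and> h ` D \<subseteq> D \<and>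
     g 0 = 0 \<and> h 0 = 0 \<and> (\<forall>z\<in>D. h (g z) = z \<and> g (h z) = z)"

lemma automorphism_pair_sym: "automorphism_pair D g h \<Longrightarrow> automorphism_pair D h g"
  unfolding automorphism_pair_def by blast

lemma automorphism_pair_compose:
  assumes "automorphism_pair D g h" "automorphism_pair D g' h'"
  shows "automorphism_pair D (\<lambda>z. g (g' z)) (\<lambda>z. h' (h z))"
proof -
  have "holomorphic_map_on (\<lambda>z. g (g' z)) D" "holomorphic_map_on (\<lambda>z. h' (h z)) D"
    using assms by (auto simp: automorphism_pair_def intro: holomorphic_map_on_compose)
  then show ?thesis
    using assms unfolding automorphism_pair_def image_subset_iff by simp
qed

abbreviation deriv0 :: "(complex ^ 'n \<Rightarrow> complex ^ 'm) \<Rightarrow> complex ^ 'n \<Rightarrow> complex ^ 'm" where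
  "deriv0 f \<equiv> frechet_derivative f (at 0)"

lemma deriv0:
  assumes "holomorphic_map_on f D" "0 \<in> D"
  shows "complex_linear (deriv0 f)" "(f has_derivative deriv0 f) (at 0)"
proof -
  obtain L where L: "complex_linear L" "(f has_derivative L) (at 0)"
    using assms holomorphic_map_onE by blast
  then have "deriv0 f = L" using frechet_derivative_at by metis
  with L show "complex_linear (deriv0 f)" "(f has_derivative deriv0 f) (at 0)" by simp_all
qed

lemma deriv0_compose:
  assumes "holomorphic_map_on f D" "holomorphic_map_on g U" "0 \<in> D" "0 \<in> U" "g 0 = 0"
  shows "deriv0 (\<lambda>z. f (g z)) = (\<lambda>v. deriv0 f (deriv0 g v))"
  using has_derivative_compose[OF deriv0(2)[OF assms(2,4)], of f "deriv0 f"] deriv0(2)[OF assms(1,3)] assms(5)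
  by (metis frechet_derivative_at)

lemma deriv0_complex_linear:
  "complex_linear L \<Longrightarrow> deriv0 L = L"
  using bounded_linear_imp_has_derivative[OF complex_linear_imp_bounded_linear] frechet_derivative_at
  by metis

lemma deriv0_inverse:
  assumes "automorphism_pair D g h" "0 \<in> D"
  shows "deriv0 h (deriv0 g v) = v"
proof -
  have g: "holomorphic_map_on g D" "holomorphic_map_on h D" "g 0 = 0" and gh: "\<And>z. z \<in> D \<Longrightarrow> h (g z) = z"
    using assms(1) by (auto simp: automorphism_pair_def)
  have "((\<lambda>z. h (g z)) has_derivative (\<lambda>v. deriv0 h (deriv0 g v))) (at 0)"
    using has_derivative_compose[OF deriv0(2)[OF g(1) assms(2)], of h] deriv0(2)[OF g(2) assms(2)] g(3) by simp
  moreover have "open D" using g by (simp add: holomorphic_map_on_def)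
  \<comment> \<open>The maps \<open>h \<circ> g\<close> and the identity agree only on
    \<open>D\<close>, which suffices because \<open>D\<close> is an open neighbourhood of
    \<open>0\<close>.\<close>
  ultimately have "((\<lambda>z. z) has_derivative (\<lambda>v. deriv0 h (deriv0 g v))) (at 0)"
    using has_derivative_transform_within_open gh assms(2) by (metis (no_types, lifting))
  then show ?thesis
    using has_derivative_unique[OF _ has_derivative_ident] by metis
qed

text \<open>All automorphisms take values in the same bounded set \<open>D\<close>, so the Cauchy
  estimates hold with constants that do not depend on the automorphism.\<close>

lemma automorphism_pair_uniform_bound:
  fixes D :: "(complex ^ 'n) set"
  assumes "open D" "bounded D" "0 \<in> D"
  obtains C r where "C \<ge> 1" "r > 0" "cball 0 r \<subseteq> D"
    "\<And>g h v. automorphism_pair D g h \<Longrightarrow> norm (deriv0 g v) \<le> C * norm v"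
    "\<And>g h x y. automorphism_pair D g h \<Longrightarrow> x \<in> cball 0 r \<Longrightarrow> y \<in> cball 0 r \<Longrightarrow>
       norm (g x - g y) \<le> C * norm (x - y)"
proof -
  obtain r0 where "r0 > 0" "cball 0 r0 \<subseteq> D" using assms open_contains_cball by blast
  then obtain r where r: "r > 0" and rD: "cball 0 (2 * r) \<subseteq> D"
    by (metis field_sum_of_halves half_gt_zero mult_2)
  obtain M where M: "M > 0" "\<And>y. y \<in> D \<Longrightarrow> norm y \<le> M"
    using assms(2) by (auto simp: bounded_pos)
  define C where "C = max 1 (real CARD('n) * M / r)"
  have C: "real CARD('n) * M / r * norm v \<le> C * norm v" for v :: "complex ^ 'n"
    by (intro mult_right_mono) (auto simp: C_def)
  have rD': "cball 0 r \<subseteq> D" using rD r by auto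
  show ?thesis
  proof (rule that[of C r])
    fix g h :: "complex ^ 'n \<Rightarrow> complex ^ 'n" assume gh: "automorphism_pair D g h"
    then have g: "holomorphic_map_on g D" and b: "\<And>y. y \<in> D \<Longrightarrow> norm (g y) \<le> M"
      using M by (auto simp: automorphism_pair_def)
    show "norm (deriv0 g v) \<le> C * norm v" for v
      using Cauchy_derivative_bound[OF g rD' r b deriv0[OF g assms(3)], of v] rD' C order_trans by blast
    show "norm (g x - g y) \<le> C * norm (x - y)" if "x \<in> cball 0 r" "y \<in> cball 0 r" for x y
      using Cauchy_lipschitz[OF g rD r b that] rD C order_trans by blast
  qed (use r rD' in \<open>auto simp: C_def\<close>)
qed

section \<open>The averaging argument\<close>

text \<open>The quantities \<open>\<Theta> g h\<close> have a finite supremum over all automorphism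
  pairs. A point with \<open>E z0 \<noteq> 0\<close> would let each of them be raised by the same
  positive amount.\<close>

lemma linearized_defect_vanishes_near_0:
  fixes D :: "(complex ^ 'n) set" and R :: "real \<Rightarrow> complex ^ 'n \<Rightarrow> complex ^ 'n"
  assumes D: "open D" "bounded D" "0 \<in> D"
    and fk: "automorphism_pair D f k"
    and R: "\<And>x. automorphism_pair D (R x) (R (- x))" "\<And>x. complex_linear (R x)"
      "\<And>x v. norm (R x v) = norm v"
    and E_def: "\<And>z. E z = deriv0 k (f z) - z"
    and s: "s > 0"
    and mean: "\<And>y. norm y \<le> s \<Longrightarrow> ((\<lambda>x. R (- x) (E (R x y))) has_integral 0) {0..1}"
  obtains e where "e > 0" "\<And>z. z \<in> ball 0 e \<Longrightarrow> E z = 0"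
proof -
  obtain C r where C: "C \<ge> 1" and r: "r > 0" "cball 0 r \<subseteq> D"
    and dC: "\<And>g h v. automorphism_pair D g h \<Longrightarrow> norm (deriv0 g v) \<le> C * norm v"
    and lC: "\<And>g h x y. automorphism_pair D g h \<Longrightarrow> x \<in> cball 0 r \<Longrightarrow> y \<in> cball 0 r \<Longrightarrow>
       norm (g x - g y) \<le> C * norm (x - y)"
    by (rule automorphism_pair_uniform_bound[OF D]) blast
  have f: "holomorphic_map_on f D" and k: "holomorphic_map_on k D"
    using fk by (auto simp: automorphism_pair_def)
  have lC0: "norm (g x) \<le> C * norm x" if "automorphism_pair D g h" "norm x \<le> r" for g h x
    using lC[OF that(1), of x 0] that r(1) by (simp add: automorphism_pair_def)
  \<comment> \<open>Two factors \<open>C\<close> are reserved: one for the preimage \<open>y\<close>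
    of \<open>z0\<close> below, giving the radius \<open>\<rho> < r\<close>, and one for the images
    \<open>g z\<close> with \<open>norm z \<le> \<rho>\<close>, giving
    \<open>C * \<rho> < s\<close>.\<close>
  define e where "e = min r (s / C) / C"
  have e: "e > 0" using C r s by (simp add: e_def)
  have "E z0 = 0" if "z0 \<in> ball 0 e" for z0
  proof (rule ccontr)
    assume nz: "E z0 \<noteq> 0"
    define \<rho> where "\<rho> = C * norm z0"
    have "\<rho> < min r (s / C)" using that C by (simp add: \<rho>_def e_def field_simps)
    then have \<rho>: "\<rho> < r" "C * \<rho> < s" using C by (auto simp: field_simps)
    have "norm z0 \<le> \<rho>" using C by (simp add: \<rho>_def mult_le_cancel_right1)
    then have z0D: "z0 \<in> D" "norm z0 \<le> r" using \<rho> r(2) by auto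
    have E: "holomorphic_map_on E D"
    proof -
      have "holomorphic_map_on (\<lambda>z. deriv0 k (f z) - z) D"
        by (intro holomorphic_map_on_diff holomorphic_map_on_compose[OF _ f, of _ D]
            complex_linear_holomorphic_map_on complex_linear_ident deriv0(1)[OF k D(3)] D(1))
          (use fk in \<open>auto simp: automorphism_pair_def\<close>)
      then show ?thesis using E_def by presburger
    qed
    define \<eta> where "\<eta> = norm (E z0) / 2"
    have \<eta>: "\<eta> > 0" using nz by (simp add: \<eta>_def)
    have "isCont E z0"
      using holomorphic_map_on_continuous_on[OF E] D(1) z0D(1) continuous_on_eq_continuous_at by blast
    then obtain \<delta> where \<delta>: "\<delta> > 0" "\<And>w. dist w z0 < \<delta> \<Longrightarrow> dist (E w) (E z0) < \<eta>"
      using \<eta> unfolding continuous_at_eps_delta by blast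
    have E\<eta>: "norm (E w) \<ge> \<eta>" if "norm (w - z0) < \<delta>" for w
    proof -
      have "norm (E z0) \<le> norm (E w) + norm (E w - E z0)"
        by (metis add.commute norm_minus_commute norm_triangle_sub)
      then show ?thesis using \<delta>(2)[of w] that by (auto simp: dist_norm \<eta>_def)
    qed
    \<comment> \<open>The mesh of the net is \<open>\<delta> / C\<close> because automorphisms
      stretch distances near \<open>0\<close> by at most \<open>C\<close>, so images of neighbouring
      points are less than \<open>\<delta>\<close> apart.\<close>
    have "\<delta> / C > 0" using \<delta>(1) C by simp
    then have cover: "cball 0 \<rho> \<subseteq> (\<Union>z\<in>cball (0 :: complex ^ 'n) \<rho>. ball z (\<delta> / C))"
      by (meson UN_I centre_in_ball subsetI)
    obtain S :: "(complex ^ 'n) set" where S: "S \<subseteq> cball 0 \<rho>" "finite S" "cball 0 \<rho> \<subseteq> (\<Union>z\<in>S. ball z (\<delta> / C))"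
      by (rule compactE_image[OF compact_cball _ cover]) auto
    have Sr: "norm z \<le> \<rho>" "norm z \<le> r" if "z \<in> S" for z using S(1) that \<rho> by auto
    \<comment> \<open>As \<open>deriv0 h\<close> inverts \<open>deriv0 g\<close>, the vector
      \<open>deriv0 h (g z)\<close> is the value at \<open>z\<close> of the map attached to
      \<open>g\<close> in the overview.\<close>
    define \<Theta> where "\<Theta> = (\<lambda>g h. \<Sum>z\<in>S. (norm (deriv0 h (g z :: complex ^ 'n) :: complex ^ 'n))\<^sup>2)"
    have bound: "\<Theta> g h \<le> (\<Sum>z\<in>S. (C * (C * norm z))\<^sup>2)" if "automorphism_pair D g h" for g h
      unfolding \<Theta>_def
    proof (intro sum_mono power_mono)
      fix z assume "z \<in> S"
      have "norm (deriv0 h (g z)) \<le> C * norm (g z)"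
        by (rule dC[OF automorphism_pair_sym[OF that]])
      also have "\<dots> \<le> C * (C * norm z)"
        using lC0[OF that] Sr \<open>z \<in> S\<close> C by (intro mult_left_mono) auto
      finally show "norm (deriv0 h (g z)) \<le> C * (C * norm z)" .
    qed simp
    define A where "A = {\<Theta> g h | g h. automorphism_pair D g h}"
    have A: "A \<noteq> {}" "bdd_above A"
      using fk bound by (auto simp: A_def bdd_above_def)
    \<comment> \<open>Compare the pair \<open>(g, h)\<close> with the pairs obtained by composing \<open>f\<close>, \<open>R x\<close> and \<open>g\<close>: their
      linearized maps differ by \<open>Y\<close>, which has mean zero in \<open>x\<close>, so that the mean square exceeds
      \<open>\<Theta> g h\<close> by the mean of the square of \<open>Y\<close>, bounded below on the net \<open>S\<close>.\<close>
    have grow: "\<Theta> g h + (\<eta> / C)\<^sup>2 \<le> Sup A" if gh: "automorphism_pair D g h" for g h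
    proof -
      have hg: "automorphism_pair D h g" by (rule automorphism_pair_sym[OF gh])
      have ghol: "holomorphic_map_on g D" "holomorphic_map_on h D" "g ` D \<subseteq> D" "g 0 = 0" "h 0 = 0"
        and inv: "\<And>z. z \<in> D \<Longrightarrow> g (h z) = z"
        using gh by (auto simp: automorphism_pair_def)
      define H where "H = deriv0 h"
      have H: "complex_linear H" unfolding H_def by (rule deriv0(1)[OF ghol(2) D(3)])
      then have Hb: "bounded_linear H" by (rule complex_linear_imp_bounded_linear)
      define Y where "Y = (\<lambda>z x. H (R (- x) (E (R x (g z)))))"
      have Yint: "(Y z has_integral 0) {0..1}" if "z \<in> S" for z
      proof -
        have "norm (g z) \<le> C * \<rho>"
          using lC0[OF gh Sr(2)[OF that]] Sr(1)[OF that] C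
          by (meson mult_left_mono order_trans zero_le_one)
        then have "norm (g z) \<le> s" using \<rho> by simp
        from has_integral_linear[OF mean[OF this] Hb] show ?thesis
          by (simp add: Y_def o_def linear_simps(3)[OF Hb])
      qed
      have RD: "R x ` D \<subseteq> D" for x using R(1) by (simp add: automorphism_pair_def)
      have Rinv: "R (- x) (R x z) = z" "R x (R (- x) z) = z" if "z \<in> D" for x z
        using R(1)[of x] that by (auto simp: automorphism_pair_def)
      have Rhol: "holomorphic_map_on (R x) D" "R x 0 = 0" for x
        using R(1)[of x] by (auto simp: automorphism_pair_def)
      \<comment> \<open>At \<open>0\<close> the new inverse has derivative
        \<open>H \<circ> R (- x) \<circ> deriv0 k\<close>, and
        \<open>deriv0 k (f v) = v + E v\<close>. The two rotations cancel on the term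
        \<open>v\<close>.\<close>
      have new: "\<Theta> (\<lambda>z. f (R x (g z))) (\<lambda>z. h (R (- x) (k z)))
          = (\<Sum>z\<in>S. (norm (H (g z) + Y z x))\<^sup>2)" for x
        unfolding \<Theta>_def
      proof (rule sum.cong[OF refl])
        fix z assume "z \<in> S"
        then have zD: "z \<in> D" using Sr r(2) by auto
        then have gzD: "g z \<in> D" using ghol by auto
        have k0: "k 0 = 0" "k ` D \<subseteq> D" using fk by (auto simp: automorphism_pair_def)
        have Rk: "holomorphic_map_on (\<lambda>z. R (- x) (k z)) D" 
          by (rule holomorphic_map_on_compose[OF Rhol(1) k k0(2)])
        have "deriv0 (\<lambda>z. h (R (- x) (k z))) = (\<lambda>v. H (deriv0 (\<lambda>z. R (- x) (k z)) v))"
          unfolding H_def using deriv0_compose[OF ghol(2) Rk D(3) D(3)] k0 Rhol by simp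
        also have "deriv0 (\<lambda>z. R (- x) (k z)) = (\<lambda>v. R (- x) (deriv0 k v))"
          using deriv0_compose[OF Rhol(1) k D(3) D(3) k0(1)] deriv0_complex_linear[OF R(2)] by simp
        finally have d: "deriv0 (\<lambda>z. h (R (- x) (k z))) = (\<lambda>v. H (R (- x) (deriv0 k v)))" .
        have "deriv0 k (f (R x (g z))) = R x (g z) + E (R x (g z))" by (simp add: E_def)
        then have "H (R (- x) (deriv0 k (f (R x (g z))))) = H (g z) + Y z x"
          using Rinv(1)[OF gzD] linear_simps(1)[OF complex_linear_imp_bounded_linear[OF R(2)]]
            linear_simps(1)[OF Hb] by (simp add: Y_def)
        then show "(norm (deriv0 (\<lambda>z. h (R (- x) (k z))) (f (R x (g z)))))\<^sup>2 = (norm (H (g z) + Y z x))\<^sup>2"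
          by (simp add: d)
      qed
      have le: "(\<Sum>z\<in>S. (norm (H (g z) + Y z x))\<^sup>2) \<le> Sup A" for x
      proof (rule cSup_upper[OF _ A(2)])
        have "automorphism_pair D (\<lambda>z. f (R x (g z))) (\<lambda>z. h (R (- x) (k z)))"
          using automorphism_pair_compose[OF fk automorphism_pair_compose[OF R(1)[of x] gh]] by simp
        then show "(\<Sum>z\<in>S. (norm (H (g z) + Y z x))\<^sup>2) \<in> A" unfolding A_def using new[of x] by force
      qed
      \<comment> \<open>The point \<open>y\<close> is sent to \<open>z0\<close> by
        \<open>R x \<circ> g\<close>, so a net point \<open>z\<close> close to \<open>y\<close>
        lands within \<open>\<delta>\<close> of \<open>z0\<close>, where \<open>E\<close> has norm
        at least \<open>\<eta>\<close>. Undoing \<open>H\<close> by \<open>deriv0 g\<close> costs at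
        most a factor \<open>C\<close>.\<close>
      have low: "(\<eta> / C)\<^sup>2 \<le> (\<Sum>z\<in>S. (norm (Y z x))\<^sup>2)" for x
      proof -
        define y where "y = h (R (- x) z0)"
        have "norm y \<le> \<rho>"
          unfolding y_def \<rho>_def using lC0[OF hg, of "R (- x) z0"] R(3) z0D by simp
        then obtain z where z: "z \<in> S" "norm (z - y) < \<delta> / C"
          using S(3) by (force simp: dist_norm)
        have "R (- x) z0 \<in> D" using RD z0D by blast
        then have gy: "R x (g y) = z0" using inv Rinv(2) z0D by (simp add: y_def)
        have "norm (R x (g z) - z0) = norm (g z - g y)"
          using R(3) linear_simps(2)[OF complex_linear_imp_bounded_linear[OF R(2)]] gy by metis
        also have "\<dots> \<le> C * norm (z - y)"
          using lC[OF gh] Sr z \<open>norm y \<le> \<rho>\<close> \<rho> by auto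
        also have "\<dots> < \<delta>" using z(2) C by (simp add: field_simps)
        finally have "\<eta> \<le> norm (E (R x (g z)))" by (rule E\<eta>)
        also have "\<dots> = norm (R (- x) (E (R x (g z))))" by (simp add: R(3))
        also have "\<dots> = norm (deriv0 g (H (R (- x) (E (R x (g z))))))"
          unfolding H_def by (simp add: deriv0_inverse[OF hg D(3)])
        also have "\<dots> \<le> C * norm (Y z x)" unfolding Y_def by (rule dC[OF gh])
        finally have "\<eta> / C \<le> norm (Y z x)" using C by (simp add: field_simps)
        then have "(\<eta> / C)\<^sup>2 \<le> (norm (Y z x))\<^sup>2" using \<eta> C by (intro power_mono) auto
        also have "\<dots> \<le> (\<Sum>z\<in>S. (norm (Y z x))\<^sup>2)"
          using z(1) S(2) by (intro member_le_sum) auto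
        finally show ?thesis .
      qed
      \<comment> \<open>The squares of \<open>Y\<close> are replaced by their constant lower bound,
        so only the cross terms remain to be integrated. They are linear in \<open>Y\<close> and
        have mean zero.\<close>
      have ptw: "(\<Sum>z\<in>S. 2 * (H (g z) \<bullet> Y z x)) + (\<Theta> g h + (\<eta> / C)\<^sup>2) \<le> Sup A" for x
      proof -
        have "(norm (H (g z) + Y z x))\<^sup>2 = (norm (H (g z)))\<^sup>2 + 2 * (H (g z) \<bullet> Y z x) + (norm (Y z x))\<^sup>2" for z
          by (simp add: power2_norm_eq_inner inner_add_left inner_add_right inner_commute)
        then have "(\<Sum>z\<in>S. (norm (H (g z) + Y z x))\<^sup>2)
          = \<Theta> g h + (\<Sum>z\<in>S. 2 * (H (g z) \<bullet> Y z x)) + (\<Sum>z\<in>S. (norm (Y z x))\<^sup>2)"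
          by (simp add: sum.distrib \<Theta>_def H_def)
        then show ?thesis using le[of x] low[of x] by linarith
      qed
      have int: "((\<lambda>x. (\<Sum>z\<in>S. 2 * (H (g z) \<bullet> Y z x)) + (\<Theta> g h + (\<eta> / C)\<^sup>2)) has_integral
          ((\<Sum>z\<in>S. 0) + (\<Theta> g h + (\<eta> / C)\<^sup>2))) {0..1}"
      proof (rule has_integral_add[OF has_integral_sum[OF S(2)]])
        fix z assume "z \<in> S"
        have "bounded_linear (\<lambda>w. 2 * (H (g z) \<bullet> w))"
          by (intro bounded_linear_mult_right[THEN bounded_linear_compose] bounded_linear_inner_right)
        from has_integral_linear[OF Yint[OF \<open>z \<in> S\<close>] this]
        show "((\<lambda>x. 2 * (H (g z) \<bullet> Y z x)) has_integral 0) {0..1}" by (simp add: o_def)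
      next
        show "((\<lambda>x. \<Theta> g h + (\<eta> / C)\<^sup>2) has_integral \<Theta> g h + (\<eta> / C)\<^sup>2) {0..1::real}"
          using has_integral_const_real[of "\<Theta> g h + (\<eta> / C)\<^sup>2" 0 1] by simp
      qed
      have "((\<lambda>x. Sup A) has_integral Sup A) {0..1::real}"
        using has_integral_const_real[of "Sup A" 0 1] by simp
      from has_integral_le[OF int this ptw] show ?thesis by simp
    qed
    have "Sup A \<le> Sup A - (\<eta> / C)\<^sup>2"
      using A(1) grow by (intro cSup_least) (auto simp: A_def le_diff_eq)
    then show False using \<eta> C by simp
  qed
  with e show ?thesis by (rule that)
qed

section \<open>Weighted rotations\<close>

lemma complex_linear_weighted_rotation: "complex_linear (weighted_rotation w \<theta>)"
  unfolding Vector_Spaces.linear_iff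
  by (auto simp: vec.vector_space_axioms weighted_rotation_def vec_eq_iff algebra_simps)

lemma norm_weighted_rotation: "norm (weighted_rotation w \<theta> z) = norm z"
  by (simp add: weighted_rotation_def norm_vec_def norm_mult)

lemma weighted_rotation_add:
  "weighted_rotation w a (weighted_rotation w b z) = weighted_rotation w (a + b) z"
  by (simp add: weighted_rotation_def vec_eq_iff cis_mult algebra_simps flip: mult.assoc)

lemma weighted_rotation_0: "weighted_rotation w 0 z = z"
  by (simp add: weighted_rotation_def vec_eq_iff)

lemma automorphism_pair_weighted_rotation:
  assumes "quasi_circular_domain w D"
  shows "automorphism_pair D (weighted_rotation w \<theta>) (weighted_rotation w (- \<theta>))"
  unfolding automorphism_pair_def
proof (intro conjI)
  have "open D" using assms by (simp add: quasi_circular_domain_def)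
  then show "holomorphic_map_on (weighted_rotation w \<theta>) D" "holomorphic_map_on (weighted_rotation w (- \<theta>)) D"
    by (auto intro: complex_linear_holomorphic_map_on complex_linear_weighted_rotation)
  show "weighted_rotation w \<theta> ` D \<subseteq> D" "weighted_rotation w (- \<theta>) ` D \<subseteq> D"
    using assms by (simp_all add: quasi_circular_domain_def)
  show "\<forall>z\<in>D. weighted_rotation w (- \<theta>) (weighted_rotation w \<theta> z) = z \<and>
      weighted_rotation w \<theta> (weighted_rotation w (- \<theta>) z) = z"
    by (simp add: weighted_rotation_add weighted_rotation_0)
qed (simp_all add: weighted_rotation_def vec_eq_iff)

section \<open>Absence of resonances\<close>

lemma norm_vec_le_mult:
  fixes v y :: "complex ^ 'n"
  assumes "\<And>i. norm (v $ i) \<le> c * norm (y $ i)" "c \<ge> 0"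
  shows "norm v \<le> c * norm y"
proof -
  have "norm v \<le> L2_set (\<lambda>i. c * norm (y $ i)) UNIV"
    unfolding norm_vec_def by (rule L2_set_mono) (use assms in auto)
  also have "\<dots> = c * norm y"
    using assms(2) by (simp add: norm_vec_def L2_set_right_distrib)
  finally show ?thesis .
qed

text \<open>Component \<open>i\<close> of the mean picks out the monomials of \<open>E $ i\<close>
  whose weight equals that of the coordinate \<open>i\<close>. Only degrees at least 2 occur: pure
  powers of the first coordinate have weight \<open>k * m\<close> with \<open>k \<ge> 2\<close>, and
  all other monomials have weight at least \<open>m + p > q\<close>. So none has weight
  \<open>m\<close>, and none has weight \<open>p\<close> or \<open>q\<close> since \<open>m\<close>
  divides neither.\<close>

lemma weighted_mean_zero:
  fixes E :: "complex ^ 3 \<Rightarrow> complex ^ 3" and m p q :: nat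
  assumes E: "holomorphic_map_on E D" "0 \<in> D" "(E has_derivative (\<lambda>_. 0)) (at 0)" "E 0 = 0"
    and w: "w = vector [int m, int p, int q]"
    and m: "0 < m" "m < p" "p < q" "q < m + p" "\<not> m dvd p" "\<not> m dvd q"
  obtains s where "s > 0" "\<And>y. norm y \<le> s \<Longrightarrow>
    ((\<lambda>x. weighted_rotation w (2 * pi * - x) (E (weighted_rotation w (2 * pi * x) y))) has_integral 0) {0..1}"
proof -
  obtain C s where C: "C \<ge> 0" and s: "s > 0" "cball 0 s \<subseteq> D"
    and lip: "\<And>\<rho> x y. \<rho> \<le> s \<Longrightarrow> x \<in> cball 0 \<rho> \<Longrightarrow> y \<in> cball 0 \<rho> \<Longrightarrow> norm (E x - E y) \<le> C * \<rho> * norm (x - y)"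
    by (rule lipschitz_of_derivative_zero[OF E(1-3)]) blast
  define d where "d = (\<lambda>i::3. nat (w $ i))"
  have d: "d 1 = m" "d 2 = p" "d 3 = q" by (simp_all add: d_def w)
  have wd: "w $ i = int (d i)" for i
    using exhaust_3[of i] by (auto simp: w d_def)
  have "((\<lambda>x. weighted_rotation w (2 * pi * - x) (E (weighted_rotation w (2 * pi * x) y))) has_integral 0) {0..1}"
    if y: "norm y \<le> s" for y
  proof -
    \<comment> \<open>\<open>\<gamma>\<close> extends the orbit of \<open>y\<close> from the unit
      circle to the disc. The point \<open>\<gamma>0 (t ^ m)\<close> is the projection of
      \<open>\<gamma> t\<close> to the first axis, written so that it visibly depends on
      \<open>t ^ m\<close> alone.\<close>
    define \<gamma> where "\<gamma> = (\<lambda>t. \<chi> i. t ^ d i * y $ i)"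
    define \<gamma>0 where "\<gamma>0 = (\<lambda>t. (\<chi> i. if i = 1 then t * y $ 1 else 0) :: complex ^ 3)"
    have pw: "norm t ^ m \<le> 1" if "norm t \<le> 1" for t :: complex
      using that by (intro power_le_one) auto
    have n\<gamma>: "norm (\<gamma> t) \<le> norm t ^ m * norm y" if "norm t \<le> 1" for t
    proof (rule norm_vec_le_mult)
      fix i
      have "m \<le> d i" using exhaust_3[of i] d m by auto
      then show "norm (\<gamma> t $ i) \<le> norm t ^ m * norm (y $ i)"
        using that by (auto simp: \<gamma>_def norm_mult norm_power intro!: mult_right_mono power_decreasing)
    qed simp
    have n\<gamma>0: "norm (\<gamma>0 (t ^ m)) \<le> norm t ^ m * norm y" for t
      by (rule norm_vec_le_mult) (auto simp: \<gamma>0_def norm_mult norm_power)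
    have n\<gamma>d: "norm (\<gamma> t - \<gamma>0 (t ^ m)) \<le> norm t ^ p * norm y" if "norm t \<le> 1" for t
    proof (rule norm_vec_le_mult)
      fix i
      show "norm ((\<gamma> t - \<gamma>0 (t ^ m)) $ i) \<le> norm t ^ p * norm (y $ i)"
        using exhaust_3[of i] d m that
        by (auto simp: \<gamma>_def \<gamma>0_def norm_mult norm_power intro!: mult_right_mono power_decreasing)
    qed simp
    have ys: "norm t ^ m * norm y \<le> s" if "norm t \<le> 1" for t :: complex
      using mult_right_mono[OF pw[OF that], of "norm y"] y by simp
    have \<gamma>s: "\<gamma> t \<in> cball 0 s" "\<gamma>0 (t ^ m) \<in> cball 0 s" if "norm t \<le> 1" for t
      using n\<gamma>[OF that] n\<gamma>0[of t] ys[OF that] by simp_all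
    have contE: "continuous_on (cball 0 s) E"
      by (rule continuous_on_subset[OF holomorphic_map_on_continuous_on[OF E(1)] s(2)])
    have hol: "(\<lambda>t. E (\<gamma> t) $ i) holomorphic_on ball 0 1" for i
      by (rule holomorphic_on_curve[OF E(1) open_ball])
        (use \<gamma>s s(2) in \<open>auto simp: \<gamma>_def intro!: holomorphic_intros\<close>)
    have hol0: "(\<lambda>t. E (\<gamma>0 (t ^ m)) $ i) holomorphic_on ball 0 1" for i
    proof (rule holomorphic_on_curve[OF E(1) open_ball])
      show "(\<lambda>t. \<gamma>0 (t ^ m) $ j) holomorphic_on ball 0 1" for j
        by (cases "j = 1") (auto simp: \<gamma>0_def intro!: holomorphic_intros)
    qed (use \<gamma>s s(2) in auto)
    have cont: "continuous_on (cball 0 1) (\<lambda>t. E (\<gamma> t) $ i)" for i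
    proof (intro continuous_on_component continuous_on_compose2[OF contE])
      show "continuous_on (cball 0 1) \<gamma>" unfolding \<gamma>_def by (intro continuous_intros)
    qed (use \<gamma>s in auto)
    \<comment> \<open>Modulo a remainder of order \<open>m + m\<close> if \<open>i = 1\<close>, and \<open>m + p > q\<close> otherwise, the function
      \<open>E (\<gamma> t) $ i\<close> is zero, respectively a function of \<open>t ^ m\<close>.\<close>
    have coeff: "(deriv ^^ d i) (\<lambda>t. E (\<gamma> t) $ i) 0 = 0" for i
    proof (cases "i = 1")
      case True
      show ?thesis
      proof (rule higher_deriv_zero_of_power_bound[OF hol])
        show "d i < m + m" using True d m by simp
        fix t :: complex assume t: "norm t < 1"
        have "norm (E (\<gamma> t) - E 0) \<le> C * (norm t ^ m * norm y) * norm (\<gamma> t - 0)"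
          using n\<gamma>[of t] ys[of t] t by (intro lip) auto
        also have "\<dots> \<le> C * (norm t ^ m * norm y) * (norm t ^ m * norm y)"
          using n\<gamma>[of t] t C by (intro mult_left_mono) auto
        also have "\<dots> = C * (norm y)\<^sup>2 * norm t ^ (m + m)"
          by (simp add: power_add power2_eq_square)
        finally show "norm (E (\<gamma> t) $ i) \<le> C * (norm y)\<^sup>2 * norm t ^ (m + m)"
          using order_trans[OF Finite_Cartesian_Product.norm_nth_le] E(4) by (metis diff_zero)
      qed
    next
      case False
      then have i: "d i = p \<or> d i = q" using exhaust_3[of i] d by auto
      have "(deriv ^^ d i) (\<lambda>t. E (\<gamma> t) $ i - E (\<gamma>0 (t ^ m)) $ i) 0 = 0"
      proof (rule higher_deriv_zero_of_power_bound)
        show "(\<lambda>t. E (\<gamma> t) $ i - E (\<gamma>0 (t ^ m)) $ i) holomorphic_on ball 0 1"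
          by (intro holomorphic_on_diff hol hol0)
        show "d i < m + p" using i m by auto
        fix t :: complex assume t: "norm t < 1"
        \<comment> \<open>The radius of the ball containing both points contributes order
          \<open>m\<close> in \<open>t\<close>, and their distance contributes order
          \<open>p\<close>.\<close>
        have "norm (E (\<gamma> t) - E (\<gamma>0 (t ^ m))) \<le> C * (norm t ^ m * norm y) * norm (\<gamma> t - \<gamma>0 (t ^ m))"
          using n\<gamma>[of t] n\<gamma>0[of t] ys[of t] t by (intro lip) auto
        also have "\<dots> \<le> C * (norm t ^ m * norm y) * (norm t ^ p * norm y)"
          using n\<gamma>d[of t] t C by (intro mult_left_mono) auto
        also have "\<dots> = C * (norm y)\<^sup>2 * norm t ^ (m + p)"
          by (simp add: power_add power2_eq_square)
        finally show "norm (E (\<gamma> t) $ i - E (\<gamma>0 (t ^ m)) $ i) \<le> C * (norm y)\<^sup>2 * norm t ^ (m + p)"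
          using order_trans[OF Finite_Cartesian_Product.norm_nth_le] by (metis vector_minus_component)
      qed
      moreover have "(deriv ^^ d i) (\<lambda>t. E (\<gamma>0 (t ^ m)) $ i) 0 = 0"
        using i m higher_deriv_zero_of_power_compose[of "\<lambda>u. E (\<gamma>0 u) $ i", OF hol0] by auto
      ultimately show ?thesis
        using higher_deriv_diff[OF hol hol0 open_ball, of 0 "d i" i i] by simp
    qed
    have rot: "weighted_rotation w (2 * pi * x) y = \<gamma> (cis (2 * pi * x))" for x
      by (simp add: weighted_rotation_def \<gamma>_def wd Complex.DeMoivre)
    show ?thesis
    proof (subst has_integral_componentwise_iff, intro ballI)
      fix b :: "complex ^ 3" assume "b \<in> Basis"
      then obtain i c where b: "b = axis i c" by (auto simp: Basis_vec_def)
      have "((\<lambda>x. cis (- (real (d i) * (2 * pi * x))) * E (\<gamma> (cis (2 * pi * x))) $ i) has_integral 0) {0..1}"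
        by (rule Fourier_coefficient_circle[OF cont hol coeff])
      from has_integral_linear[OF this bounded_linear_inner_left[of c]]
      show "((\<lambda>x. weighted_rotation w (2 * pi * - x) (E (weighted_rotation w (2 * pi * x) y)) \<bullet> b)
          has_integral 0 \<bullet> b) {0..1}"
        unfolding rot by (simp add: o_def b inner_axis weighted_rotation_def wd)
    qed
  qed
  with s(1) show ?thesis by (rule that)
qed

section \<open>Linearity of the automorphism\<close>

lemma automorphism_pair_inv_into:
  assumes f: "holomorphic_automorphism D f" "f 0 = 0" and "0 \<in> D"
  shows "automorphism_pair D f (inv_into D f)"
proof -
  have b: "bij_betw f D D" using f by (simp add: holomorphic_automorphism_def)
  have "inv_into D f 0 = 0" using bij_betw_inv_into_left[OF b assms(3)] f(2) by simp
  then show ?thesis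
    using f bij_betw_inv_into_left[OF b] bij_betw_inv_into_right[OF b]
      bij_betw_imp_surj_on[OF b] bij_betw_imp_surj_on[OF bij_betw_inv_into[OF b]]
    unfolding automorphism_pair_def holomorphic_automorphism_def by simp
qed

theorem corollary3p3:
  fixes p1 p2 m :: int
    and D :: "(complex ^ 3) set"
    and f :: "complex ^ 3 \<Rightarrow> complex ^ 3"
  assumes "prime p1" and "odd p1" and "prime p2" and "odd p2"
    and "5 \<le> p1" and "p1 < p2"
    and "p2 - p1 < m" and "m < p1"
    and "quasi_circular_domain (vector [m, p1, p2]) D"
    and "bounded D" and "0 \<in> D"
    and "holomorphic_automorphism D f" and "f 0 = 0"
  shows "\<exists>L. complex_linear L \<and> (\<forall>z\<in>D. f z = L z)"
proof -
  define w :: "int ^ 3" where "w = vector [m, p1, p2]"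
  have D: "open D" "connected D" and qc: "quasi_circular_domain w D"
    using assms(9) by (auto simp: w_def quasi_circular_domain_def)
  define k where "k = inv_into D f"
  have fk: "automorphism_pair D f k"
    unfolding k_def using assms by (intro automorphism_pair_inv_into)
  then have f: "holomorphic_map_on f D" and k: "holomorphic_map_on k D" and "f ` D \<subseteq> D" "k 0 = 0"
    by (auto simp: automorphism_pair_def)
  note f' = deriv0[OF f \<open>0 \<in> D\<close>] and k' = deriv0[OF k \<open>0 \<in> D\<close>]
  define E where "E = (\<lambda>z. deriv0 k (f z) - z)"
  have E: "holomorphic_map_on E D"
    unfolding E_def
    by (intro holomorphic_map_on_diff holomorphic_map_on_compose[OF _ f, of _ D]
        complex_linear_holomorphic_map_on complex_linear_ident k'(1) D(1) \<open>f ` D \<subseteq> D\<close>)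
  have E': "(E has_derivative (\<lambda>_. 0)) (at 0)"
  proof -
    have "((\<lambda>z. deriv0 k (f z)) has_derivative (\<lambda>v. deriv0 k (deriv0 f v))) (at 0)"
      by (rule bounded_linear.has_derivative[OF complex_linear_imp_bounded_linear[OF k'(1)] f'(2)])
    then have "((\<lambda>z. deriv0 k (f z)) has_derivative (\<lambda>v. v)) (at 0)"
      by (simp add: deriv0_inverse[OF fk \<open>0 \<in> D\<close>])
    from has_derivative_diff[OF this has_derivative_ident] show ?thesis
      by (simp add: E_def)
  qed
  have E0: "E 0 = 0"
    using linear_simps(3)[OF complex_linear_imp_bounded_linear[OF k'(1)]] \<open>f 0 = 0\<close> by (simp add: E_def)
  \<comment> \<open>From \<open>p2 - p1 \<ge> 1\<close> it follows that \<open>m > 1\<close>, so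
    \<open>m\<close> is neither of the two positive divisors of a larger prime.\<close>
  have ndvd: "\<not> m dvd p" if "prime p" "m < p" for p
  proof
    have "1 < m" "0 \<le> m" using assms(6,7) by linarith+
    assume "m dvd p"
    then have "m = 1 \<or> m = p" using \<open>0 \<le> m\<close> that(1) unfolding prime_int_iff by blast
    then show False using \<open>1 < m\<close> that(2) by auto
  qed
  have w': "w = vector [int (nat m), int (nat p1), int (nat p2)]"
    using assms(5-8) by (simp add: w_def)
  have nd: "\<not> nat m dvd nat p1" "\<not> nat m dvd nat p2"
    using ndvd[of p1] ndvd[of p2] assms(1,3,5-8) by (simp_all add: nat_dvd_iff)
  \<comment> \<open>The condition \<open>p2 - p1 < m\<close> is the inequality
    \<open>q < m + p\<close> that rules out mixed resonances.\<close>
  obtain s where s: "s > 0" "\<And>y. norm y \<le> s \<Longrightarrow>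
    ((\<lambda>x. weighted_rotation w (2 * pi * - x) (E (weighted_rotation w (2 * pi * x) y))) has_integral 0) {0..1}"
    using assms(5-8) by (auto intro: weighted_mean_zero[OF E \<open>0 \<in> D\<close> E' E0 w' _ _ _ _ nd])
  have R: "automorphism_pair D (weighted_rotation w (2 * pi * x)) (weighted_rotation w (2 * pi * - x))" for x
    using automorphism_pair_weighted_rotation[OF qc, of "2 * pi * x"] by simp
  obtain e where e: "e > 0" "\<And>z. z \<in> ball 0 e \<Longrightarrow> E z = 0"
    using linearized_defect_vanishes_near_0[where R = "\<lambda>x. weighted_rotation w (2 * pi * x)",
        OF D(1) assms(10,11) fk R complex_linear_weighted_rotation norm_weighted_rotation _ s]
    unfolding E_def by blast
  \<comment> \<open>Once \<open>E\<close> vanishes on \<open>D\<close>, the linear map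
    \<open>deriv0 k\<close> undoes \<open>f\<close> there, and \<open>deriv0 f\<close> is its
    inverse.\<close>
  have "f z = deriv0 f z" if "z \<in> D" for z
  proof -
    have "E z = 0" by (rule holomorphic_map_identity_theorem[OF E D(2) \<open>0 \<in> D\<close> e that])
    then have "deriv0 k (f z) = z" by (simp add: E_def)
    then show ?thesis
      using deriv0_inverse[OF automorphism_pair_sym[OF fk] \<open>0 \<in> D\<close>, of "f z"] by simp
  qed
  then show ?thesis using f'(1) by blast
qed

end
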